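(* Let $\alpha\in(0,1)$ and $N\ge2$. Let $P$ be the transfer operator of the discrete cat map $T_N$ on $X_N=(\mathbb{Z}/N\mathbb{Z})^2$ and let $\widetilde{u}_N(x)=[(I-\alpha P)^{-1}]_{x,x}$. Then $$\widetilde{u}_N(0)=\frac{1}{1-\alpha}>\widetilde{u}_N(x)\qquad\text{for all } x\in X_N,\ x\neq 0.$$
   Context: $A=\begin{pmatrix}1&1\\1&2\end{pmatrix}$, and $T_N(x)=Ax \bmod N$ on $X_N$ (a bijection). The transfer operator acts on functions $f:X_N\to\mathbb{C}$ by $(Pf)(x)=f(A^{-1}x \bmod N)$; operators are identified with matrices indexed by $X_N\times X_N$. *)

theory Defs
  imports "HOL-Analysis.Analysis"
begin

definition cat_matrix :: "int ^ 2 ^ 2" where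
  "cat_matrix = vector [vector [1, 1], vector [1, 2]]"

definition reduce_mod :: "nat \<Rightarrow> int ^ 2 \<Rightarrow> int ^ 2" where
  "reduce_mod N x = (\<chi> i. x $ i mod int N)"

text \<open>\<open>(\<int>/N\<int>)\<^sup>2\<close>, represented by the integer vectors with both entries in \<open>{0..<N}\<close>.\<close>

definition discrete_torus :: "nat \<Rightarrow> (int ^ 2) set" where
  "discrete_torus N = {x. \<forall>i. x $ i \<in> {0..<int N}}"

definition cat_map :: "nat \<Rightarrow> int ^ 2 \<Rightarrow> int ^ 2" where
  "cat_map N x = reduce_mod N (cat_matrix *v x)"

text \<open>A function \<open>X\<^sub>N \<rightarrow> \<complex>\<close> is an element of \<open>discrete_torus N \<rightarrow>\<^sub>E UNIV\<close>, so that
  equality of functions and invertibility of operators are those on \<open>X\<^sub>N\<close>.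
  The inverse \<open>matrix_inv cat_matrix\<close> is taken over the integers.\<close>

definition transfer_op :: "nat \<Rightarrow> (int ^ 2 \<Rightarrow> complex) \<Rightarrow> int ^ 2 \<Rightarrow> complex" where
  "transfer_op N f =
     (\<lambda>x\<in>discrete_torus N. f (reduce_mod N (matrix_inv cat_matrix *v x)))"

definition id_minus_transfer ::
    "nat \<Rightarrow> real \<Rightarrow> (int ^ 2 \<Rightarrow> complex) \<Rightarrow> int ^ 2 \<Rightarrow> complex" where
  "id_minus_transfer N \<alpha> f =
     (\<lambda>x\<in>discrete_torus N. f x - complex_of_real \<alpha> * transfer_op N f x)"

definition resolvent ::
    "nat \<Rightarrow> real \<Rightarrow> (int ^ 2 \<Rightarrow> complex) \<Rightarrow> int ^ 2 \<Rightarrow> complex" where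
  "resolvent N \<alpha> = inv_into (discrete_torus N \<rightarrow>\<^sub>E UNIV) (id_minus_transfer N \<alpha>)"

text \<open>The \<open>(x, y)\<close> entry of an operator, i.e. the value at \<open>x\<close> of the image of the
  indicator function of \<open>y\<close>.\<close>

definition op_entry ::
    "nat \<Rightarrow> ((int ^ 2 \<Rightarrow> complex) \<Rightarrow> int ^ 2 \<Rightarrow> complex) \<Rightarrow> int ^ 2 \<Rightarrow> int ^ 2 \<Rightarrow> complex" where
  "op_entry N B x y = B (\<lambda>z\<in>discrete_torus N. if z = y then 1 else 0) x"

definition u_tilde :: "nat \<Rightarrow> real \<Rightarrow> int ^ 2 \<Rightarrow> complex" where
  "u_tilde N \<alpha> x = op_entry N (resolvent N \<alpha>) x x"


lemma matrix_inv_cat_matrix: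
  "matrix_inv cat_matrix = vector [vector [2, - 1], vector [- 1, 1]]"
proof -
  let ?B = "vector [vector [2, - 1], vector [- 1, 1]] :: int ^ 2 ^ 2"
  have AB: "cat_matrix ** ?B = mat 1" "?B ** cat_matrix = mat 1"
    by (simp_all add: cat_matrix_def matrix_matrix_mult_def mat_def vec_eq_iff
        sum_2 forall_2)
  then have "\<exists>C. cat_matrix ** C = mat 1 \<and> C ** cat_matrix = mat 1" by blast
  then have "matrix_inv cat_matrix ** cat_matrix = mat 1"
    unfolding matrix_inv_def by (rule someI2_ex) blast
  then have "matrix_inv cat_matrix = matrix_inv cat_matrix ** (cat_matrix ** ?B)"
    by (simp add: AB(1))
  also have "\<dots> = ?B"
    by (subst matrix_mul_assoc) (simp add: \<open>matrix_inv cat_matrix ** cat_matrix = mat 1\<close>)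
  finally show ?thesis .
qed

lemma reduce_mod_in_torus: "N > 0 \<Longrightarrow> reduce_mod N x \<in> discrete_torus N"
  by (simp add: reduce_mod_def discrete_torus_def)

lemma cat_matrix_mult:
  "cat_matrix *v x = vector [x $ 1 + x $ 2, x $ 1 + 2 * x $ 2]"
  "matrix_inv cat_matrix *v x = vector [2 * x $ 1 - x $ 2, x $ 2 - x $ 1]"
  unfolding matrix_inv_cat_matrix
  by (simp_all add: cat_matrix_def matrix_vector_mult_def vec_eq_iff sum_2 forall_2)

lemma cat_map_inverse:
  assumes "x \<in> discrete_torus N"
  shows "reduce_mod N (matrix_inv cat_matrix *v cat_map N x) = x"
    and "cat_map N (reduce_mod N (matrix_inv cat_matrix *v x)) = x"
proof -
  have x: "x $ 1 mod int N = x $ 1" "x $ 2 mod int N = x $ 2"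
    using assms by (auto simp: discrete_torus_def)
  note cong = mod_diff_cong mod_add_cong mod_mult_cong mod_mod_trivial refl
  have e1: "(2 * ((a + b) mod m) - (a + 2 * b) mod m) mod m = a mod m" for a b m :: int
  proof -
    have "(2 * ((a + b) mod m) - (a + 2 * b) mod m) mod m = (2 * (a + b) - (a + 2 * b)) mod m"
      by (intro cong)
    then show ?thesis by simp
  qed
  have e4: "((2 * a - b) mod m + 2 * ((b - a) mod m)) mod m = b mod m" for a b m :: int
  proof -
    have "((2 * a - b) mod m + 2 * ((b - a) mod m)) mod m = ((2 * a - b) + 2 * (b - a)) mod m"
      by (intro cong)
    then show ?thesis by simp
  qed
  have e2: "((a + 2 * b) mod m - (a + b) mod m) mod m = b mod m"
    and e3: "((2 * a - b) mod m + (b - a) mod m) mod m = a mod m" for a b m :: int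
    by (simp_all add: mod_simps)
  show "reduce_mod N (matrix_inv cat_matrix *v cat_map N x) = x"
    using e1[of "x $ 1" "x $ 2" "int N"] e2[of "x $ 1" "x $ 2" "int N"] x
    by (simp add: cat_matrix_mult cat_map_def reduce_mod_def vec_eq_iff forall_2)
  show "cat_map N (reduce_mod N (matrix_inv cat_matrix *v x)) = x"
    using e3[of "x $ 1" "x $ 2" "int N"] e4[of "x $ 1" "x $ 2" "int N"] x
    by (simp add: cat_matrix_mult cat_map_def reduce_mod_def vec_eq_iff forall_2)
qed

lemma bij_betw_cat_map:
  assumes "N > 0"
  shows "bij_betw (cat_map N) (discrete_torus N) (discrete_torus N)"
  by (rule bij_betw_byWitness[where f' = "\<lambda>x. reduce_mod N (matrix_inv cat_matrix *v x)"])
    (use assms in \<open>auto simp: cat_map_inverse reduce_mod_in_torus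
      reduce_mod_in_torus[of N "cat_matrix *v _", folded cat_map_def]\<close>)

lemma transfer_op_cat_map:
  assumes "N > 0" "x \<in> discrete_torus N"
  shows "transfer_op N f (cat_map N x) = f x"
  using assms by (simp add: transfer_op_def cat_map_inverse cat_map_def reduce_mod_in_torus
      cat_map_inverse[unfolded cat_map_def])

lemma finite_discrete_torus: "finite (discrete_torus N)"
proof -
  have "discrete_torus N \<subseteq> (\<lambda>(a, b). vector [a, b]) ` ({0..<int N} \<times> {0..<int N})"
  proof
    fix x assume "x \<in> discrete_torus N"
    moreover have "x = vector [x $ 1, x $ 2]" by (simp add: vec_eq_iff forall_2)
    ultimately show "x \<in> (\<lambda>(a, b). vector [a, b]) ` ({0..<int N} \<times> {0..<int N})"
      unfolding discrete_torus_def by (intro image_eqI[of _ _ "(x $ 1, x $ 2)"]) auto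
  qed
  then show ?thesis by (rule finite_subset) simp
qed

lemma bij_betw_id_minus_transfer:
  assumes N: "N > 0" and \<alpha>: "0 < \<alpha>" "\<alpha> < 1"
  shows "bij_betw (id_minus_transfer N \<alpha>)
           (discrete_torus N \<rightarrow>\<^sub>E UNIV) (discrete_torus N \<rightarrow>\<^sub>E UNIV)"
proof -
  let ?X = "discrete_torus N"
  define S where "S x = reduce_mod N (matrix_inv cat_matrix *v x)" for x
  have S: "S x \<in> ?X" for x using N by (simp add: S_def reduce_mod_in_torus)
  have SX: "(S ^^ k) x \<in> ?X" if "x \<in> ?X" for k x
    using that S by (cases k) auto
  have L: "id_minus_transfer N \<alpha> f x = f x - of_real \<alpha> * f (S x)" if "x \<in> ?X" for f x
    using that by (simp add: id_minus_transfer_def transfer_op_def S_def)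
  have bd: "\<exists>M. \<forall>x\<in>?X. norm (h x) \<le> M" for h :: "int ^ 2 \<Rightarrow> complex"
    using finite_discrete_torus[of N]
    by (intro exI[of _ "\<Sum>x\<in>?X. norm (h x)"]) (auto intro: member_le_sum)
  have lim: "(\<lambda>k. \<alpha> ^ k * M) \<longlonglongrightarrow> 0" for M
    using tendsto_mult_right[OF LIMSEQ_realpow_zero, of \<alpha> M] \<alpha> by simp
  have inj: "inj_on (id_minus_transfer N \<alpha>) (?X \<rightarrow>\<^sub>E UNIV)"
  proof (rule inj_onI)
    fix f g assume f: "f \<in> ?X \<rightarrow>\<^sub>E UNIV" and g: "g \<in> ?X \<rightarrow>\<^sub>E UNIV"
      and eq: "id_minus_transfer N \<alpha> f = id_minus_transfer N \<alpha> g"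
    define d where "d x = f x - g x" for x
    have step: "d x = of_real \<alpha> * d (S x)" if "x \<in> ?X" for x
      using L[OF that, of f] L[OF that, of g] eq by (simp add: d_def algebra_simps)
    have iter: "d x = of_real \<alpha> ^ k * d ((S ^^ k) x)" if "x \<in> ?X" for x k
    proof (induction k)
      case (Suc k)
      show ?case using Suc step[OF SX[OF that, of k]] by (simp add: algebra_simps)
    qed simp
    obtain M where M: "\<forall>x\<in>?X. norm (d x) \<le> M" using bd by blast
    have "d x = 0" if "x \<in> ?X" for x
    proof -
      have "norm (d x) \<le> \<alpha> ^ k * M" for k
      proof -
        have "norm (d x) = \<alpha> ^ k * norm (d ((S ^^ k) x))"
          by (subst iter[OF that, of k]) (use \<alpha> in \<open>simp add: norm_mult norm_power\<close>)
        also have "\<dots> \<le> \<alpha> ^ k * M"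
          using M SX[OF that] \<alpha> by (intro mult_left_mono) auto
        finally show ?thesis .
      qed
      then have "norm (d x) \<le> 0" by (intro LIMSEQ_le_const[OF lim]) auto
      then show ?thesis by simp
    qed
    then show "f = g" using f g by (intro PiE_ext[OF f g]) (simp add: d_def)
  qed
  have surj: "h \<in> id_minus_transfer N \<alpha> ` (?X \<rightarrow>\<^sub>E UNIV)" if h: "h \<in> ?X \<rightarrow>\<^sub>E UNIV" for h
  proof -
    define t where "t x k = of_real \<alpha> ^ k * h ((S ^^ k) x)" for x k
    obtain M where M: "\<forall>x\<in>?X. norm (h x) \<le> M" using bd by blast
    have sm: "summable (t x)" if "x \<in> ?X" for x
    proof (rule summable_comparison_test')
      show "summable (\<lambda>k. \<alpha> ^ k * M)"
        using \<alpha> by (intro summable_mult2 summable_geometric) auto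
      show "norm (t x k) \<le> \<alpha> ^ k * M" if "0 \<le> k" for k
        using M SX[OF \<open>x \<in> ?X\<close>] \<alpha>
        by (auto simp: t_def norm_mult norm_power intro!: mult_left_mono)
    qed
    define g where "g = (\<lambda>x\<in>?X. \<Sum>k. t x k)"
    have "id_minus_transfer N \<alpha> g x = h x" if "x \<in> ?X" for x
    proof -
      have "t x (Suc k) = of_real \<alpha> * t (S x) k" for k
        by (simp add: t_def funpow_Suc_right del: funpow.simps)
      then have "(\<Sum>k. t x (Suc k)) = of_real \<alpha> * (\<Sum>k. t (S x) k)"
        using suminf_mult[OF sm[OF S, of x]] by simp
      moreover have "(\<Sum>k. t x (Suc k)) = (\<Sum>k. t x k) - t x 0"
        by (rule suminf_split_head[OF sm[OF that]])
      ultimately have "suminf (t x) = h x + of_real \<alpha> * suminf (t (S x))"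
        by (simp add: t_def[of x 0] algebra_simps)
      then show ?thesis using that S by (simp add: L g_def)
    qed
    then have "id_minus_transfer N \<alpha> g = h"
      by (intro PiE_ext[OF _ h]) (auto simp: id_minus_transfer_def)
    then show ?thesis by (intro image_eqI[of _ _ g]) (auto simp: g_def)
  qed
  show ?thesis unfolding bij_betw_def
    using inj surj by (auto simp: id_minus_transfer_def)
qed

end

theory Submission
  imports Defs
begin

text \<open>Expanding the resolvent as a Neumann series, \<open>u\<^sub>N(x)\<close> is the sum of those \<open>\<alpha>\<^sup>k\<close> for which
  \<open>A\<^sup>-\<^sup>k x = x\<close>. At the fixed point \<open>0\<close> this is the full geometric series. Since \<open>det (A - I) = -1\<close>,
  the map \<open>A - I\<close> is invertible modulo every \<open>N\<close>, so \<open>0\<close> is the only fixed point and every other \<open>x\<close>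
  misses at least the term \<open>\<alpha>\<close>.\<close>

text \<open>The inverse dynamics on representatives: on the torus, \<open>transfer_op N f\<close> is
  \<open>f\<close> composed with this map, so powers of the operator become its iterates.\<close>

definition inv_cat_map :: "nat \<Rightarrow> int ^ 2 \<Rightarrow> int ^ 2" where
  "inv_cat_map N x = reduce_mod N (matrix_inv cat_matrix *v x)"

lemma inv_cat_map_zero: "inv_cat_map N 0 = 0"
  by (simp add: inv_cat_map_def reduce_mod_def vec_eq_iff)

lemma inv_cat_map_fixed_imp_zero:
  assumes x: "x \<in> discrete_torus N" and fixed: "inv_cat_map N x = x"
  shows "x = 0"
proof -
  have bounds: "0 \<le> x $ i" "x $ i < int N" for i
    using x by (auto simp: discrete_torus_def)
  have "(2 * x $ 1 - x $ 2) mod int N = x $ 1" "(x $ 2 - x $ 1) mod int N = x $ 2"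
    using fixed unfolding inv_cat_map_def reduce_mod_def cat_matrix_mult vec_eq_iff forall_2
    by simp_all
  then have "(2 * x $ 1 - x $ 2) mod int N = x $ 1 mod int N"
    "(x $ 2 - x $ 1) mod int N = x $ 2 mod int N"
    by (metis mod_mod_trivial)+
  \<comment> \<open>In the first congruence the two sides differ by \<open>x $ 1 - x $ 2\<close>, in
    the second by \<open>- (x $ 1)\<close>. Both coordinates lie in [0, N), where 0 is the only
    multiple of N.\<close>
  then have dvd: "int N dvd x $ 1 - x $ 2" "int N dvd - (x $ 1)"
    by (simp_all add: mod_eq_dvd_iff algebra_simps)
  then have x1: "x $ 1 = 0"
    using bounds[of 1] zdvd_not_zless[of "x $ 1" "int N"] by fastforce
  moreover have "x $ 2 = 0"
    using dvd(1) x1 bounds[of 2] zdvd_not_zless[of "x $ 2" "int N"] by fastforce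
  ultimately show ?thesis by (simp add: vec_eq_iff forall_2)
qed

lemma summable_power_of_bool:
  fixes \<alpha> :: real
  assumes "0 \<le> \<alpha>" "\<alpha> < 1"
  shows "summable (\<lambda>k. \<alpha> ^ k * of_bool (Q k))"
  by (rule summable_comparison_test'[OF summable_geometric[of \<alpha>], of 0]) (use assms in auto)

text \<open>The k-th power of the operator sends the indicator of \<open>y\<close> to the indicator
  of the points that reach \<open>y\<close> after k inverse steps. The resulting Neumann series is
  checked pointwise to solve the resolvent equation, so no convergence of operators is
  involved.\<close>

lemma op_entry_resolvent:
  assumes N: "N > 0" and \<alpha>: "0 < \<alpha>" "\<alpha> < 1" and x: "x \<in> discrete_torus N"
  shows "op_entry N (resolvent N \<alpha>) x y =
    complex_of_real (\<Sum>k. \<alpha> ^ k * of_bool ((inv_cat_map N ^^ k) x = y))"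
proof -
  define r where "r z = (\<Sum>k. \<alpha> ^ k * of_bool ((inv_cat_map N ^^ k) z = y))" for z
  define g where "g = (\<lambda>z\<in>discrete_torus N. complex_of_real (r z))"
  define e where "e = (\<lambda>z\<in>discrete_torus N. if z = y then 1 else 0 :: complex)"
  note summable = summable_power_of_bool[OF less_imp_le[OF \<alpha>(1)] \<alpha>(2)]
  \<comment> \<open>Telescoping: passing to \<open>inv_cat_map N z\<close> and multiplying by
    \<alpha> shifts the series by one index, which leaves only the term k = 0.\<close>
  have r: "r z - \<alpha> * r (inv_cat_map N z) = of_bool (z = y)" for z
  proof -
    have "\<alpha> * r (inv_cat_map N z) = (\<Sum>k. \<alpha> * (\<alpha> ^ k * of_bool ((inv_cat_map N ^^ k) (inv_cat_map N z) = y)))"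
      unfolding r_def by (rule suminf_mult[OF summable, symmetric])
    also have "\<dots> = (\<Sum>k. \<alpha> ^ Suc k * of_bool ((inv_cat_map N ^^ Suc k) z = y))"
      by (simp add: funpow_Suc_right mult.assoc del: funpow.simps)
    also have "\<dots> = r z - of_bool (z = y)"
      unfolding r_def by (subst suminf_split_head[OF summable]) simp
    finally show ?thesis by simp
  qed
  have "id_minus_transfer N \<alpha> g z = e z" if "z \<in> discrete_torus N" for z
  proof -
    have "id_minus_transfer N \<alpha> g z = complex_of_real (r z - \<alpha> * r (inv_cat_map N z))"
      using that N
      by (simp add: id_minus_transfer_def transfer_op_def g_def inv_cat_map_def
          reduce_mod_in_torus)
    then show ?thesis using that by (simp add: r e_def)
  qed
  then have "id_minus_transfer N \<alpha> g = e"
    by (intro PiE_ext[of _ "discrete_torus N" "\<lambda>_. UNIV"])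
      (auto simp: id_minus_transfer_def e_def)
  \<comment> \<open>Injectivity of \<open>id_minus_transfer\<close> makes \<open>g\<close> the only
    preimage of \<open>e\<close>, hence the one chosen by \<open>inv_into\<close>.\<close>
  then have "resolvent N \<alpha> e = g"
    unfolding resolvent_def
    by (intro inv_into_f_eq[OF bij_betw_imp_inj_on[OF bij_betw_id_minus_transfer[OF N \<alpha>]]])
      (auto simp: g_def)
  then show ?thesis
    using x by (simp add: op_entry_def e_def g_def r_def)
qed

theorem corollary4p4:
  fixes \<alpha> :: real and N :: nat
  assumes "0 < \<alpha>" and "\<alpha> < 1" and "N \<ge> 2"
  shows "u_tilde N \<alpha> 0 = complex_of_real (1 / (1 - \<alpha>)) \<and>
    (\<forall>x \<in> discrete_torus N. x \<noteq> 0 \<longrightarrow>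
       u_tilde N \<alpha> x \<in> \<real> \<and> Re (u_tilde N \<alpha> x) < 1 / (1 - \<alpha>))"
proof -
  define r where "r x = (\<Sum>k. \<alpha> ^ k * of_bool ((inv_cat_map N ^^ k) x = x))" for x
  have u: "u_tilde N \<alpha> x = complex_of_real (r x)" if "x \<in> discrete_torus N" for x
    unfolding u_tilde_def r_def using assms that by (intro op_entry_resolvent) auto
  have geom: "summable (\<lambda>k. \<alpha> ^ k)" "(\<Sum>k. \<alpha> ^ k) = 1 / (1 - \<alpha>)"
    using assms by (auto intro: summable_geometric suminf_geometric)
  have "(inv_cat_map N ^^ k) 0 = 0" for k
    by (induction k) (simp_all add: inv_cat_map_zero)
  then have "r 0 = 1 / (1 - \<alpha>)"
    by (simp add: r_def geom)
  moreover have "0 \<in> discrete_torus N"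
    using assms by (simp add: discrete_torus_def)
  moreover have "r x < 1 / (1 - \<alpha>)" if x: "x \<in> discrete_torus N" "x \<noteq> 0" for x
  proof -
    have sm: "summable (\<lambda>k. \<alpha> ^ k * of_bool ((inv_cat_map N ^^ k) x = x))"
      using assms by (intro summable_power_of_bool) auto
    \<comment> \<open>The termwise gap to the geometric series is never negative, and at k = 1 it
      equals \<alpha> because \<open>x\<close> is not fixed.\<close>
    have "0 < (\<Sum>k. \<alpha> ^ k - \<alpha> ^ k * of_bool ((inv_cat_map N ^^ k) x = x))"
    proof (rule suminf_pos2[of _ 1])
      show "summable (\<lambda>k. \<alpha> ^ k - \<alpha> ^ k * of_bool ((inv_cat_map N ^^ k) x = x))"
        by (rule summable_diff[OF geom(1) sm])
      show "0 < \<alpha> ^ 1 - \<alpha> ^ 1 * of_bool ((inv_cat_map N ^^ 1) x = x)"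
        using inv_cat_map_fixed_imp_zero[OF x(1)] x(2) assms(1) by auto
    qed (use assms in auto)
    also have "\<dots> = 1 / (1 - \<alpha>) - r x"
      unfolding r_def geom(2)[symmetric] by (rule suminf_diff[OF geom(1) sm, symmetric])
    finally show ?thesis by simp
  qed
  ultimately show ?thesis by (simp add: u)
qed

end
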